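(* The sequence $\left(|I_k(123,132,213,231)|\right)_{k\ge 0}$ is the Pascal triangle read row by row (starting with $\binom{0}{0}$ at $k=0$), except that all values greater than $1$ are replaced by $0$. Its generating function is \[\sum_{k\ge 0}|I_k(123,132,213,231)|\,x^k=\sum_{i\ge 0}\left(x^{i(i+1)/2}+x^{(i+1)(i+4)/2}\right).\]
   Context: A permutation of length $n$ is a word $\pi=\pi_1\cdots\pi_n$ containing each of $1,\dots,n$ exactly once. The sum of permutations $\rho=\rho_1\cdots\rho_n$ and $\tau=\tau_1\cdots\tau_m$ is the permutation $\rho\oplus\tau=\rho_1\cdots\rho_n(n+\tau_1)\cdots(n+\tau_m)$ of length $n+m$. A permutation is decomposable if it equals $\rho\oplus\tau$ for some non-empty permutations $\rho,\tau$; a non-empty permutation that is not decomposable is indecomposable. An inversion of $\pi$ is a pair $(i,j)$ with $i<j$ and $\pi_i>\pi_j$. A permutation $\pi$ contains a permutation (pattern) $\tau=\tau_1\cdots\tau_m$ if there are indices $i_1<\dots<i_m$ such that $\pi_{i_1},\dots,\pi_{i_m}$ is order-isomorphic to $\tau_1,\dots,\tau_m$; otherwise $\pi$ avoids $\tau$. $I_k(\tau_1,\dots,\tau_r)$ denotes the (finite) set of all indecomposable permutations, of any length, with exactly $k$ inversions that avoid all of $\tau_1,\dots,\tau_r$. Reading the Pascal triangle row by row means listing $\binom{0}{0},\binom{1}{0},\binom{1}{1},\binom{2}{0},\binom{2}{1},\binom{2}{2},\dots$ *)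

theory Defs
  imports
    "HOL-Combinatorics.Multiset_Permutations"
    "HOL-Computational_Algebra.Formal_Power_Series"
begin

text \<open>
  Permutations are words over the positive integers, given as lists. List positions start
  at 0, whereas the values of a permutation of length \<open>n\<close> are \<open>1, \<dots>, n\<close>.
\<close>

definition is_perm :: "nat list \<Rightarrow> bool" where
  "is_perm p \<longleftrightarrow> p \<in> permutations_of_set {1..length p}"

definition perm_sum :: "nat list \<Rightarrow> nat list \<Rightarrow> nat list" where
  "perm_sum r t = r @ map (\<lambda>x. length r + x) t"

definition decomposable :: "nat list \<Rightarrow> bool" where
  "decomposable p \<longleftrightarrow>
     (\<exists>r t. is_perm r \<and> is_perm t \<and> r \<noteq> [] \<and> t \<noteq> [] \<and> p = perm_sum r t)"

definition indecomposable :: "nat list \<Rightarrow> bool" where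
  "indecomposable p \<longleftrightarrow> is_perm p \<and> p \<noteq> [] \<and> \<not> decomposable p"

definition inversions :: "nat list \<Rightarrow> (nat \<times> nat) set" where
  "inversions p = {(i, j). i < j \<and> j < length p \<and> p ! i > p ! j}"

definition contains_pattern :: "nat list \<Rightarrow> nat list \<Rightarrow> bool" where
  "contains_pattern p t \<longleftrightarrow>
     (\<exists>f. strict_mono_on {..<length t} f \<and> f ` {..<length t} \<subseteq> {..<length p} \<and>
          (\<forall>a<length t. \<forall>b<length t. p ! f a < p ! f b \<longleftrightarrow> t ! a < t ! b))"

abbreviation avoids_pattern :: "nat list \<Rightarrow> nat list \<Rightarrow> bool" where
  "avoids_pattern p t \<equiv> \<not> contains_pattern p t"

definition indec_avoiders :: "nat \<Rightarrow> nat list set \<Rightarrow> nat list set" where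
  "indec_avoiders k T =
     {p. indecomposable p \<and> card (inversions p) = k \<and> (\<forall>t\<in>T. avoids_pattern p t)}"

text \<open>
  The \<open>k\<close>-th entry (counted from 0) of the Pascal triangle read row by row. The rows
  \<open>0, \<dots>, k\<close> have at least \<open>k + 1\<close> entries, so the index is always in range.
\<close>

definition pascal_row :: "nat \<Rightarrow> nat list" where
  "pascal_row n = map (\<lambda>j. n choose j) [0..<Suc n]"

definition pascal_seq :: "nat \<Rightarrow> nat" where
  "pascal_seq k = concat (map pascal_row [0..<Suc k]) ! k"

lemma length_concat_pascal_rows:
  "length (concat (map pascal_row [0..<n])) = n * (n + 1) div 2"
  by (induction n) (simp_all add: pascal_row_def)

lemma concat_pascal_rows_nth:
  assumes "n < m" "j \<le> n"
  shows "concat (map pascal_row [0..<m]) ! (n * (n + 1) div 2 + j) = n choose j"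
proof -
  have "[0..<m] = [0..<n] @ n # [Suc n..<m]"
    using assms by (metis le_add1 plus_nat.add_0 upt_add_eq_append upt_conv_Cons less_imp_le
      le_add_diff_inverse)
  then have "concat (map pascal_row [0..<m]) ! (n * (n + 1) div 2 + j) =
     (concat (map pascal_row [0..<n]) @ (pascal_row n @ concat (map pascal_row [Suc n..<m])))
       ! (length (concat (map pascal_row [0..<n])) + j)"
    by (simp add: length_concat_pascal_rows[simplified])
  also have "\<dots> = (pascal_row n @ concat (map pascal_row [Suc n..<m])) ! j"
    by (rule nth_append_length_plus)
  also have "\<dots> = n choose j"
    using assms by (simp add: pascal_row_def nth_append del: upt_Suc)
  finally show ?thesis .
qed

lemma pascal_seq_eq_binomial:
  assumes "j \<le> n"
  shows "pascal_seq (n * (n + 1) div 2 + j) = n choose j"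
proof -
  have "n \<le> n * (n + 1) div 2"
    by (induction n) simp_all
  then have "n < Suc (n * (n + 1) div 2 + j)" by linarith
  then show ?thesis
    unfolding pascal_seq_def using assms by (rule concat_pascal_rows_nth)
qed

text \<open>Finiteness of the sets being counted, so that \<^const>\<open>card\<close> is the true cardinality.\<close>

lemma finite_inversions: "finite (inversions p)"
  by (rule finite_subset[of _ "{..<length p} \<times> {..<length p}"]) (auto simp: inversions_def)

lemma is_permD:
  assumes "is_perm p"
  shows "set p = {1..length p}" "distinct p"
  using assms by (auto simp: is_perm_def dest: permutations_of_setD)

lemma is_permI:
  assumes "set p = {1..length p}" "distinct p"
  shows "is_perm p"
  using assms by (auto simp: is_perm_def permutations_of_set_def)

lemma indecomposable_crossing_inversion:
  assumes p: "indecomposable p" and i: "0 < i" "i < length p"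
  obtains a b where "(a, b) \<in> inversions p" "a < i" "i \<le> b"
proof (rule ccontr)
  assume "\<not> thesis"
  with that have no: "\<And>a b. (a, b) \<in> inversions p \<Longrightarrow> a < i \<Longrightarrow> i \<le> b \<Longrightarrow> False" by blast
  have perm: "is_perm p" using p by (simp add: indecomposable_def)
  note sp = is_permD[OF perm]
  define r where "r = take i p"
  define u where "u = drop i p"
  have pru: "p = r @ u" by (simp add: r_def u_def)
  have lr: "length r = i" using i by (simp add: r_def)
  have dr: "distinct r" and du: "distinct u" and disj: "set r \<inter> set u = {}"
    using sp(2) pru by auto
  have cr: "card (set r) = i" using distinct_card[OF dr] lr by simp
  have lt: "x < y" if xy: "x \<in> set r" "y \<in> set u" for x y
  proof -
    obtain a where a: "a < i" "r ! a = x" using xy lr by (metis in_set_conv_nth)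
    obtain b where b: "b < length u" "u ! b = y" using xy by (metis in_set_conv_nth)
    have pa: "p ! a = x" using a lr by (simp add: pru nth_append)
    have pb: "p ! (i + b) = y" using b lr by (simp add: pru nth_append)
    have "i + b < length p" using b lr by (simp add: pru)
    then have "\<not> x > y" using no[of a "i + b"] a pa pb by (auto simp: inversions_def)
    moreover have "x \<noteq> y" using xy disj by auto
    ultimately show ?thesis by simp
  qed
  have "x \<le> i" if x: "x \<in> set r" for x
  proof -
    have "{1..x} \<subseteq> set r"
    proof
      fix y assume y: "y \<in> {1..x}"
      have "x \<in> set p" using x pru by auto
      then have "y \<in> set p" using y sp(1) by auto
      then have "y \<in> set r \<or> y \<in> set u" using pru by auto
      then show "y \<in> set r" using lt[OF x, of y] y by auto
    qed
    then have "card {1..x} \<le> card (set r)" by (intro card_mono) auto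
    then show ?thesis using cr by simp
  qed
  moreover have "set r \<subseteq> set p" using pru by auto
  ultimately have "set r \<subseteq> {1..i}" using sp(1) by auto
  then have sr: "set r = {1..i}" using cr by (intro card_subset_eq) auto
  have "set u = set p - set r" using pru disj by auto
  then have su: "set u = {Suc i..length p}" using sr sp(1) by auto
  define t where "t = map (\<lambda>x. x - i) u"
  have lt': "length t = length p - i" by (simp add: t_def u_def)
  have "(\<lambda>x. x - i) ` {Suc i..length p} = {1..length p - i}"
  proof (intro equalityI subsetI)
    fix y assume "y \<in> {1..length p - i}"
    then have "y = (y + i) - i" "y + i \<in> {Suc i..length p}" by auto
    then show "y \<in> (\<lambda>x. x - i) ` {Suc i..length p}" by (rule image_eqI)
  qed auto
  then have st: "set t = {1..length t}" using su lt' by (simp add: t_def)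
  have "inj_on (\<lambda>x. x - i) (set u)" by (rule inj_onI) (auto simp: su)
  then have dt: "distinct t" using du by (simp add: t_def distinct_map)
  have mt: "map (\<lambda>x. length r + x) t = u"
    unfolding t_def by (simp add: lr o_def) (rule map_idI, auto simp: su)
  have "is_perm r" using sr lr dr by (intro is_permI) auto
  moreover have "is_perm t" using st dt by (rule is_permI)
  moreover have "p = perm_sum r t" using mt pru by (simp add: perm_sum_def)
  moreover have "r \<noteq> []" "t \<noteq> []" using lr lt' i by auto
  ultimately have "decomposable p" unfolding decomposable_def by blast
  then show False using p by (simp add: indecomposable_def)
qed

lemma inversion_span_le:
  assumes p: "is_perm p" and ab: "(a, b) \<in> inversions p"
  shows "b - a \<le> card (inversions p)"
proof -
  define g where "g c = (if p ! c < p ! a then (a, c) else (c, b))" for c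
  have "g ` {a<..b} \<subseteq> inversions p"
    using ab by (auto simp: g_def inversions_def intro: le_neq_implies_less)
  moreover have "inj_on g {a<..b}"
    by (rule inj_onI) (auto simp: g_def split: if_splits)
  ultimately have "card {a<..b} \<le> card (inversions p)"
    using card_inj_on_le finite_inversions by blast
  then show ?thesis by simp
qed

lemma indecomposable_length_le:
  assumes p: "indecomposable p"
  shows "length p \<le> Suc (card (inversions p) * card (inversions p))"
proof -
  let ?I = "inversions p"
  have perm: "is_perm p" using p by (simp add: indecomposable_def)
  have sub: "{0<..<length p} \<subseteq> (\<Union>(a, b)\<in>?I. {a<..b})"
  proof
    fix i assume "i \<in> {0<..<length p}"
    then obtain a b where "(a, b) \<in> ?I" "a < i" "i \<le> b"
      using indecomposable_crossing_inversion[OF p, of i] by auto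
    then show "i \<in> (\<Union>(a, b)\<in>?I. {a<..b})" by (intro UN_I[of "(a, b)"]) auto
  qed
  have "length p - 1 = card {0<..<length p}" by simp
  also have "\<dots> \<le> card (\<Union>(a, b)\<in>?I. {a<..b})"
    by (rule card_mono[OF _ sub]) (auto simp: finite_inversions)
  also have "\<dots> \<le> (\<Sum>(a, b)\<in>?I. card {a<..b})"
    using card_UN_le[OF finite_inversions, of "\<lambda>(a, b). {a<..b}" p] by (simp add: case_prod_beta)
  also have "\<dots> \<le> (\<Sum>(a, b)\<in>?I. card ?I)"
    by (intro sum_mono) (auto intro: inversion_span_le[OF perm, simplified])
  also have "\<dots> = card ?I * card ?I" by simp
  finally show ?thesis by simp
qed

lemma finite_indec_avoiders: "finite (indec_avoiders k T)"
proof (rule finite_subset)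
  show "indec_avoiders k T \<subseteq> (\<Union>n\<le>Suc (k * k). permutations_of_set {1..n})"
    using indecomposable_length_le
    by (force simp: indec_avoiders_def indecomposable_def is_perm_def)
qed auto

end

theory Submission
  imports Defs
begin

text \<open>
  The patterns 123, 132, 213, 231 are exactly the permutations of length 3 that do not begin
  with 3. Hence a permutation avoids all four iff in every triple of positions the leftmost
  entry is the largest (\<open>avoids_iff_triple_max\<close>). In a permutation of length at least 3 this forces
  the first entry to exceed all others; removing it and repeating, one is left with two
  entries in arbitrary order. So for each length \<open>n \<ge> 2\<close> there are exactly two avoiders,
  \<open>n \<dots> 3 2 1\<close> and \<open>n \<dots> 3 1 2\<close> (\<open>triple_max_perm_cases\<close>). A permutation that begins with its
  largest entry is indecomposable, so among all avoiders only the empty word and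
  \<open>1 2 = 1 \<oplus> 1\<close> are lost (\<open>indecomposable_triple_max_iff\<close>).

  Write \<open>T n = n (n + 1) / 2\<close>. The decreasing word of length \<open>i + 1\<close> has \<open>T i\<close> inversions, and
  \<open>n \<dots> 3 1 2\<close> with \<open>n = i + 3\<close> has one inversion less than the decreasing word of the same
  length, namely \<open>T (i + 2) - 1 = (i + 1) (i + 4) / 2\<close>. Counting both
  families by inversions gives the generating function; the series converges because both
  exponents are at least \<open>i\<close>. For the Pascal triangle, every \<open>k\<close> is uniquely
  \<open>T n + j\<close> with \<open>j \<le> n\<close>, and entry \<open>k\<close> is then \<open>n choose j\<close>. The exponents \<open>T i\<close> are
  the positions with \<open>j = 0\<close>, and the exponents \<open>T (i + 2) - 1 = T (i + 1) + (i + 1)\<close> are those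
  with \<open>j = n \<ge> 1\<close>; these are exactly the entries equal to 1, each hit once.
\<close>

section \<open>Avoidance as a condition on triples\<close>

text \<open>
  Among any three entries the leftmost is strictly the largest; vacuous for words of length at
  most 2.
\<close>

definition triple_max :: "nat list \<Rightarrow> bool" where
  "triple_max p \<longleftrightarrow> (\<forall>i j l. i < j \<and> j < l \<and> l < length p \<longrightarrow> p ! j < p ! i \<and> p ! l < p ! i)"

lemma contains_pattern_tripleI:
  assumes "i < j" "j < l" "l < length p"
    and "p ! i < p ! j \<longleftrightarrow> a < b" "p ! j < p ! i \<longleftrightarrow> b < a"
    and "p ! i < p ! l \<longleftrightarrow> a < c" "p ! l < p ! i \<longleftrightarrow> c < a"
    and "p ! j < p ! l \<longleftrightarrow> b < c" "p ! l < p ! j \<longleftrightarrow> c < b"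
  shows "contains_pattern p [a, b, c]"
proof -
  have less3: "x = 0 \<or> x = 1 \<or> x = 2" if "x < length [a, b, c]" for x using that by auto
  show ?thesis unfolding contains_pattern_def
  proof (intro exI[of _ "\<lambda>x. [i, j, l] ! x"] conjI allI impI)
    show "strict_mono_on {..<length [a, b, c]} (\<lambda>x. [i, j, l] ! x)"
    proof (rule strict_mono_onI)
      fix r s assume "r \<in> {..<length [a, b, c]}" "s \<in> {..<length [a, b, c]}" "r < s"
      then show "[i, j, l] ! r < [i, j, l] ! s"
        using less3[of r] less3[of s] assms by auto
    qed
    show "(\<lambda>x. [i, j, l] ! x) ` {..<length [a, b, c]} \<subseteq> {..<length p}"
      using assms by (auto simp: less_Suc_eq)
    fix r s assume "r < length [a, b, c]" "s < length [a, b, c]"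
    then have "r = 0 \<or> r = 1 \<or> r = 2" "s = 0 \<or> s = 1 \<or> s = 2" by (auto intro: less3)
    then show "p ! ([i, j, l] ! r) < p ! ([i, j, l] ! s) \<longleftrightarrow> [a, b, c] ! r < [a, b, c] ! s"
      by (elim disjE) (simp_all add: assms(4-9))
  qed
qed

lemma contains_pattern_tripleE:
  assumes "contains_pattern p [a, b, c]"
  obtains i j l where "i < j" "j < l" "l < length p"
    "p ! j < p ! i \<longleftrightarrow> b < a" "p ! l < p ! i \<longleftrightarrow> c < a"
proof -
  obtain f where f: "strict_mono_on {..<3} f" "f ` {..<3} \<subseteq> {..<length p}"
      "\<forall>x<3. \<forall>y<3. p ! f x < p ! f y \<longleftrightarrow> [a, b, c] ! x < [a, b, c] ! y"
    using assms by (auto simp: contains_pattern_def numeral_3_eq_3)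
  show ?thesis
  proof (rule that)
    show "f 0 < f 1" "f 1 < f 2" using f(1) by (auto simp: strict_mono_on_def)
    show "f 2 < length p" using f(2) by (auto simp: image_subset_iff)
    show "p ! f 1 < p ! f 0 \<longleftrightarrow> b < a" "p ! f 2 < p ! f 0 \<longleftrightarrow> c < a" using f(3) by auto
  qed
qed

lemma avoids_iff_triple_max:
  assumes "distinct p"
  shows "(\<forall>t\<in>{[1,2,3], [1,3,2], [2,1,3], [2,3,1]}. avoids_pattern p t) \<longleftrightarrow> triple_max p"
proof
  assume av: "\<forall>t\<in>{[1,2,3], [1,3,2], [2,1,3], [2,3,1]}. avoids_pattern p t"
  show "triple_max p" unfolding triple_max_def
  proof (intro allI impI)
    fix i j l assume ijl: "i < j \<and> j < l \<and> l < length p"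
    then have ne: "p ! i \<noteq> p ! j" "p ! i \<noteq> p ! l" "p ! j \<noteq> p ! l"
      using assms by (auto simp: nth_eq_iff_index_eq)
    note pat = contains_pattern_tripleI[of i j l p]
    show "p ! j < p ! i \<and> p ! l < p ! i"
    proof (rule ccontr)
      assume "\<not> ?thesis"
      with ne consider "p ! i < p ! j" "p ! j < p ! l" | "p ! i < p ! l" "p ! l < p ! j"
        | "p ! j < p ! i" "p ! i < p ! l" | "p ! l < p ! i" "p ! i < p ! j"
        by linarith
      then show False
      proof cases
        case 1 then show False using pat[of 1 2 3] ijl av by simp
      next
        case 2 then show False using pat[of 1 3 2] ijl av by simp
      next
        case 3 then show False using pat[of 2 1 3] ijl av by simp
      next
        case 4 then show False using pat[of 2 3 1] ijl av by simp
      qed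
    qed
  qed
next
  assume tm: "triple_max p"
  have "b < a \<and> c < a" if "contains_pattern p [a, b, c]" for a b c
    using that tm by (elim contains_pattern_tripleE) (auto simp: triple_max_def)
  then show "\<forall>t\<in>{[1,2,3], [1,3,2], [2,1,3], [2,3,1]}. avoids_pattern p t"
    by fastforce
qed

section \<open>The two families of avoiders\<close>

text \<open>The decreasing permutation \<open>n \<dots> 2 1\<close> of length \<open>n\<close>.\<close>

definition decr :: "nat \<Rightarrow> nat list" where
  "decr n = rev [1..<Suc n]"

text \<open>
  The decreasing permutation with its last two entries exchanged. The parameter \<open>n\<close> counts the
  entries in front of the final \<open>1 2\<close>, so the length is \<open>n + 2\<close>.
\<close>

definition decr_swap :: "nat \<Rightarrow> nat list" where
  "decr_swap n = rev [3..<n + 3] @ [1, 2]"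

lemma decr_0 [simp]: "decr 0 = []"
  and decr_Suc [simp]: "decr (Suc n) = Suc n # decr n"
  by (simp_all add: decr_def)

lemma decr_swap_0 [simp]: "decr_swap 0 = [1, 2]"
  and decr_swap_Suc [simp]: "decr_swap (Suc n) = (n + 3) # decr_swap n"
  using upt_Suc_append[of 3 "n + 3"] by (simp_all add: decr_swap_def del: upt_Suc)

lemma length_decr [simp]: "length (decr n) = n"
  and length_decr_swap [simp]: "length (decr_swap n) = n + 2"
  by (simp_all add: decr_def decr_swap_def)

lemma decr_neq_decr_swap: "decr m \<noteq> decr_swap n"
proof
  assume eq: "decr m = decr_swap n"
  then have "m = n + 2" by (metis length_decr length_decr_swap)
  moreover have "last (decr (Suc l)) = 1" for l by (induction l) auto
  moreover have "last (decr_swap n) = 2" by (simp add: decr_swap_def)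
  ultimately show False using eq by (metis add_2_eq_Suc' numeral_eq_one_iff semiring_norm(85))
qed

text \<open>
  Prepending a new largest entry neither creates nor destroys the permutation property; both
  families arise in this way, and the classification below undoes such steps.
\<close>

lemma is_perm_Cons_Suc_length:
  "is_perm (Suc (length q) # q) \<longleftrightarrow> is_perm q"
proof
  assume "is_perm (Suc (length q) # q)"
  then have "insert (Suc (length q)) (set q) = insert (Suc (length q)) {1..length q}"
    "Suc (length q) \<notin> set q" "distinct q"
    using is_permD[of "Suc (length q) # q"] by (auto simp: atLeastAtMostSuc_conv)
  moreover have "Suc (length q) \<notin> {1..length q}" by simp
  ultimately show "is_perm q" by (intro is_permI) (metis insert_ident)+
next
  assume "is_perm q"
  then show "is_perm (Suc (length q) # q)"
    using is_permD[of q] by (intro is_permI) (auto simp: atLeastAtMostSuc_conv)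
qed

lemma is_perm_decr: "is_perm (decr n)"
proof (induction n)
  case 0 show ?case by (simp add: is_perm_def)
next
  case (Suc n) then show ?case using is_perm_Cons_Suc_length[of "decr n"] by simp
qed

lemma is_perm_decr_swap: "is_perm (decr_swap n)"
proof (induction n)
  case 0 show ?case by (intro is_permI) auto
next
  case (Suc n) then show ?case
    using is_perm_Cons_Suc_length[of "decr_swap n"] by (simp add: numeral_3_eq_3)
qed

text \<open>
  The bound on the length is needed: each entry of \<open>q\<close> must lie in a triple together with \<open>x\<close>.
\<close>

lemma triple_max_Cons:
  assumes "length q \<ge> 2"
  shows "triple_max (x # q) \<longleftrightarrow> (\<forall>y\<in>set q. y < x) \<and> triple_max q"
proof
  assume tm: "triple_max (x # q)"
  have "q ! m < x" if "m < length q" for m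
    \<comment> \<open>The second and third position are those of \<open>q ! 0\<close> and \<open>q ! m\<close>; for \<open>m = 0\<close> the third is
      that of \<open>q ! 1\<close>.\<close>
    using tm[unfolded triple_max_def, rule_format, of 0 1 "Suc (max m 1)"] that assms
    by (cases m) auto
  moreover have "triple_max q" unfolding triple_max_def
  proof (intro allI impI)
    fix i j l assume "i < j \<and> j < l \<and> l < length q"
    then show "q ! j < q ! i \<and> q ! l < q ! i"
      using tm[unfolded triple_max_def, rule_format, of "Suc i" "Suc j" "Suc l"] by simp
  qed
  ultimately show "(\<forall>y\<in>set q. y < x) \<and> triple_max q" by (auto simp: in_set_conv_nth)
next
  assume "(\<forall>y\<in>set q. y < x) \<and> triple_max q"
  then show "triple_max (x # q)" unfolding triple_max_def
    by (auto simp: nth_Cons split: nat.splits)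
qed

lemma triple_max_decr: "triple_max (decr n)"
proof (induction n)
  case (Suc n)
  have "\<forall>y\<in>set (decr n). y < Suc n" by (auto simp: decr_def)
  with Suc show ?case
    by (cases "n \<ge> 2") (auto simp: triple_max_Cons, auto simp: triple_max_def)
qed (simp add: triple_max_def)

lemma triple_max_decr_swap: "triple_max (decr_swap n)"
proof (induction n)
  case (Suc n)
  have "\<forall>y\<in>set (decr_swap n). y < n + 3" by (auto simp: decr_swap_def)
  with Suc show ?case by (simp add: triple_max_Cons)
qed (auto simp: triple_max_def)

lemma triple_max_perm_cases:
  assumes "is_perm p" "triple_max p" "length p = n + 2"
  shows "p = decr (n + 2) \<or> p = decr_swap n"
  using assms
proof (induction n arbitrary: p)
  case 0
  then obtain x y where p: "p = [x, y]" by (auto simp: length_Suc_conv numeral_2_eq_2)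
  have "{1..2} = {1, 2 :: nat}" by auto
  then have "{x, y} = {1, 2}" using is_permD(1)[OF 0(1)] p by (simp add: numeral_2_eq_2)
  then show ?case by (auto simp: p numeral_2_eq_2 doubleton_eq_iff)
next
  case (Suc n)
  then obtain x q where p: "p = x # q" and q: "length q = n + 2" by (cases p) auto
  then have lt: "\<forall>y\<in>set q. y < x" and tm: "triple_max q"
    using Suc.prems(2) by (simp_all add: triple_max_Cons)
  have sp: "insert x (set q) = {1..n + 3}" using is_permD(1)[OF Suc.prems(1)] p q by simp
  then have "n + 3 \<in> insert x (set q)" "x \<le> n + 3" by auto
  with lt have x: "x = n + 3" by fastforce
  then have "is_perm q" using Suc.prems(1) is_perm_Cons_Suc_length[of q] p q
    by (simp add: numeral_3_eq_3)
  from Suc.IH[OF this tm q] show ?case by (auto simp: p x)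
qed

section \<open>Inversions\<close>

lemma card_inversions_Cons:
  assumes "\<forall>y\<in>set q. y < x"
  shows "card (inversions (x # q)) = length q + card (inversions q)"
proof -
  \<comment> \<open>The inversions that involve position 0, and those inherited from \<open>q\<close>.\<close>
  let ?A = "(\<lambda>j. (0::nat, Suc j)) ` {..<length q}" and ?B = "map_prod Suc Suc ` inversions q"
  have "inversions (x # q) = ?A \<union> ?B"
  proof (intro equalityI subsetI)
    fix z assume "z \<in> inversions (x # q)"
    then obtain i j where z: "z = (i, j)" "i < j" "j < Suc (length q)" "(x # q) ! j < (x # q) ! i"
      by (auto simp: inversions_def)
    then obtain j' where j': "j = Suc j'" by (cases j) auto
    show "z \<in> ?A \<union> ?B"
      using z j' by (cases i) (auto simp: inversions_def map_prod_def image_iff)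
  qed (use assms in \<open>auto simp: inversions_def\<close>)
  moreover have "card (?A \<union> ?B) = card ?A + card ?B"
    by (intro card_Un_disjoint finite_imageI finite_inversions) auto
  moreover have "card ?A = length q" by (subst card_image) (auto intro: inj_onI)
  moreover have "card ?B = card (inversions q)"
    by (rule card_image) (auto intro!: inj_onI)
  ultimately show ?thesis by simp
qed

lemma card_inversions_decr: "card (inversions (decr (Suc n))) = n * (n + 1) div 2"
proof (induction n)
  case 0
  have "inversions [1] = {}" by (auto simp: inversions_def)
  then show ?case by simp
next
  case (Suc n)
  have "\<forall>y\<in>set (decr (Suc n)). y < Suc (Suc n)" by (auto simp: decr_def)
  from card_inversions_Cons[OF this] Suc show ?case by simp
qed

lemma card_inversions_decr_swap:
  "card (inversions (decr_swap (Suc n))) = (n + 1) * (n + 4) div 2"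
proof (induction n)
  case 0
  have "inversions [1, 2] = {}" by (auto simp: inversions_def less_Suc_eq)
  then show ?case using card_inversions_Cons[of "[1, 2]" 3] by simp
next
  case (Suc n)
  have "\<forall>y\<in>set (decr_swap (Suc n)). y < Suc n + 3" by (auto simp: decr_swap_def)
  from card_inversions_Cons[OF this]
  have "card (inversions (decr_swap (Suc (Suc n)))) = n + 3 + (n + 1) * (n + 4) div 2"
    using Suc by simp
  also have "\<dots> = (2 * (n + 3) + (n + 1) * (n + 4)) div 2" by simp
  also have "2 * (n + 3) + (n + 1) * (n + 4) = (Suc n + 1) * (Suc n + 4)"
    by (simp add: algebra_simps)
  finally show ?case .
qed

section \<open>Indecomposable avoiders\<close>

lemma indecomposable_if_hd_eq_length:
  assumes "is_perm p" "p \<noteq> []" "hd p = length p"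
  shows "indecomposable p"
  unfolding indecomposable_def
proof (intro conjI notI)
  assume "decomposable p"
  then obtain r t where rt: "is_perm r" "r \<noteq> []" "t \<noteq> []" "p = perm_sum r t"
    by (auto simp: decomposable_def)
  have "hd r \<in> {1..length r}" using is_permD(1)[OF rt(1)] hd_in_set[OF rt(2)] by simp
  moreover have "hd p = hd r" "length p = length r + length t"
    using rt by (simp_all add: perm_sum_def)
  moreover have "length t > 0" using rt by simp
  ultimately show False using assms(3) by simp
qed (use assms in auto)

lemma not_indecomposable_12: "\<not> indecomposable [1, 2]"
proof -
  have "is_perm [1]" by (intro is_permI) auto
  moreover have "[1, 2] = perm_sum [1] [1]" by (simp add: perm_sum_def)
  ultimately show ?thesis unfolding indecomposable_def decomposable_def by blast
qed

lemma indecomposable_triple_max_iff: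
  "indecomposable p \<and> triple_max p \<longleftrightarrow>
     (\<exists>i. p = decr (Suc i)) \<or> (\<exists>i. p = decr_swap (Suc i))"
proof
  assume p: "indecomposable p \<and> triple_max p"
  then have perm: "is_perm p" and "p \<noteq> []" by (auto simp: indecomposable_def)
  show "(\<exists>i. p = decr (Suc i)) \<or> (\<exists>i. p = decr_swap (Suc i))"
  proof (cases "length p = 1")
    case True
    then have "p = decr (Suc 0)" using is_permD(1)[OF perm] by (auto simp: length_Suc_conv)
    then show ?thesis by blast
  next
    case False
    moreover have "length p \<noteq> 0" using \<open>p \<noteq> []\<close> by simp
    ultimately have "length p = (length p - 2) + 2" by linarith
    then obtain n where n: "length p = n + 2" by blast
    from triple_max_perm_cases[OF perm _ n] p consider "p = decr (n + 2)" | "p = decr_swap n" by blast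
    then show ?thesis
    proof cases
      case 1 then show ?thesis by (metis add_2_eq_Suc')
    next
      case 2
      then have "n \<noteq> 0" using p not_indecomposable_12 decr_swap_0 by metis
      then show ?thesis using 2 not0_implies_Suc by blast
    qed
  qed
next
  assume "(\<exists>i. p = decr (Suc i)) \<or> (\<exists>i. p = decr_swap (Suc i))"
  then consider i where "p = decr (Suc i)" | i where "p = decr_swap (Suc i)" by blast
  then show "indecomposable p \<and> triple_max p"
  proof cases
    case 1
    then have "p \<noteq> []" "hd p = length p" by simp_all
    then show ?thesis
      using 1 indecomposable_if_hd_eq_length is_perm_decr triple_max_decr by blast
  next
    case 2
    then have "p \<noteq> []" "hd p = length p" by simp_all
    then show ?thesis
      using 2 indecomposable_if_hd_eq_length is_perm_decr_swap triple_max_decr_swap by blast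
  qed
qed

lemma card_indec_avoiders:
  "card (indec_avoiders k {[1,2,3], [1,3,2], [2,1,3], [2,3,1]}) =
     card {i. i * (i + 1) div 2 = k} + card {i. (i + 1) * (i + 4) div 2 = k}"
proof -
  let ?P = "{i. i * (i + 1) div 2 = k}" and ?Q = "{i. (i + 1) * (i + 4) div 2 = k}"
  let ?A = "(\<lambda>i. decr (Suc i)) ` ?P" and ?B = "(\<lambda>i. decr_swap (Suc i)) ` ?Q"
  have "indec_avoiders k {[1,2,3], [1,3,2], [2,1,3], [2,3,1]} =
      {p. (indecomposable p \<and> triple_max p) \<and> card (inversions p) = k}"
    unfolding indec_avoiders_def
    using avoids_iff_triple_max is_permD(2) indecomposable_def by blast
  also have "\<dots> = ?A \<union> ?B"
    unfolding indecomposable_triple_max_iff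
    using card_inversions_decr card_inversions_decr_swap by fastforce
  finally have eq: "indec_avoiders k {[1,2,3], [1,3,2], [2,1,3], [2,3,1]} = ?A \<union> ?B" .
  then have "finite (?A \<union> ?B)" using finite_indec_avoiders by metis
  then have "card (?A \<union> ?B) = card ?A + card ?B"
    using decr_neq_decr_swap by (intro card_Un_disjoint) (auto simp del: decr_Suc decr_swap_Suc)
  moreover have "card ?A = card ?P"
    by (rule card_image) (rule inj_onI, simp)
  moreover have "card ?B = card ?Q"
    by (rule card_image) (rule inj_onI, simp)
  ultimately show ?thesis using eq by simp
qed

section \<open>Positions of the ones in the Pascal triangle\<close>

lemma triangular_Suc: "Suc n * (Suc n + 1) div 2 = n * (n + 1) div 2 + Suc n" for n :: nat
  by simp

lemma triangular_mono: "m \<le> n \<Longrightarrow> m * (m + 1) div 2 \<le> n * (n + 1) div 2" for m n :: nat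
  by (intro div_le_mono mult_le_mono) auto

lemma triangular_position_exists:
  obtains n j :: nat where "k = n * (n + 1) div 2 + j" "j \<le> n"
proof -
  have "\<exists>n j. k = n * (n + 1) div 2 + j \<and> j \<le> n"
  proof (induction k)
    case 0 show ?case by (intro exI[of _ 0]) simp
  next
    case (Suc k)
    then obtain n j where nj: "k = n * (n + 1) div 2 + j" "j \<le> n" by blast
    show ?case
    proof (cases "j = n")
      case True
      then have "Suc k = Suc n * (Suc n + 1) div 2 + 0" using nj triangular_Suc[of n] by simp
      then show ?thesis by blast
    next
      case False
      then have "Suc k = n * (n + 1) div 2 + Suc j \<and> Suc j \<le> n" using nj by simp
      then show ?thesis by blast
    qed
  qed
  then show ?thesis using that by blast
qed

text \<open>
  Row \<open>n\<close> occupies the positions from the \<open>n\<close>-th triangular number up to, but not including,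
  the next one, so different rows do not overlap.
\<close>

lemma triangular_position_unique:
  fixes m n i j :: nat
  assumes "m * (m + 1) div 2 + i = n * (n + 1) div 2 + j" "i \<le> m" "j \<le> n"
  shows "m = n \<and> i = j"
proof -
  have less: "a * (a + 1) div 2 + c < b * (b + 1) div 2 + d" if "a < b" "c \<le> a" for a b c d :: nat
    using triangular_mono[of "Suc a" b] triangular_Suc[of a] that by linarith
  have "m = n" using less[of m n i j] less[of n m j i] assms by (metis less_irrefl linorder_neqE_nat)
  then show ?thesis using assms by simp
qed

text \<open>The second family of exponents points at the last entry of row \<open>i + 1\<close>.\<close>

lemma swap_exponent: "(i + 1) * (i + 4) div 2 = Suc i * (Suc i + 1) div 2 + Suc i" for i :: nat
proof -
  have "(i + 1) * (i + 4) = Suc i * (Suc i + 1) + 2 * Suc i" by (simp add: algebra_simps)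
  then show ?thesis by simp
qed

lemma binomial_gt_1:
  assumes "0 < j" "j < n"
  shows "1 < n choose j"
proof -
  obtain i m where j: "j = Suc i" and n: "n = Suc m" using assms by (cases j; cases n) auto
  have "0 < m choose i" "0 < m choose Suc i"
    using assms j n by (auto intro!: zero_less_binomial)
  then have "1 < (m choose i) + (m choose Suc i)" by linarith
  then show ?thesis by (simp add: j n)
qed

lemma card_exponents_eq_pascal:
  "card {i. i * (i + 1) div 2 = k} + card {i. (i + 1) * (i + 4) div 2 = k} =
     (if pascal_seq k > 1 then 0 else pascal_seq k)"
proof -
  obtain n j where k: "k = n * (n + 1) div 2 + j" and j: "j \<le> n"
    by (rule triangular_position_exists)
  have P: "{i. i * (i + 1) div 2 = k} = (if j = 0 then {n} else {})"
    using triangular_position_unique[of _ 0 n j] j k by auto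
  have "(i + 1) * (i + 4) div 2 = k \<longleftrightarrow> Suc i = n \<and> Suc i = j" for i
    unfolding swap_exponent using triangular_position_unique[of "Suc i" "Suc i" n j] j k by auto
  then have "{i. (i + 1) * (i + 4) div 2 = k} = {i. Suc i = n \<and> Suc i = j}"
    by (rule Collect_cong)
  also have "\<dots> = (if j = n \<and> n > 0 then {n - 1} else {})" by (cases n) auto
  finally have Q: "{i. (i + 1) * (i + 4) div 2 = k} = (if j = n \<and> n > 0 then {n - 1} else {})" .
  have pas: "pascal_seq k = n choose j" unfolding k by (rule pascal_seq_eq_binomial[OF j])
  consider "j = 0" | "j = n" "n > 0" | "0 < j" "j < n" using j by linarith
  then have "card (if j = 0 then {n} else {}) + card (if j = n \<and> n > 0 then {n - 1} else {}) =
      (if n choose j > 1 then 0 else n choose j)"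
  proof cases
    case 3 then show ?thesis using binomial_gt_1[OF 3] by (simp del: One_nat_def)
  qed auto
  then show ?thesis unfolding P Q pas .
qed

section \<open>The generating function\<close>

text \<open>
  The hypotheses \<open>i \<le> f i\<close> and \<open>i \<le> g i\<close> make the \<open>k\<close>-th coefficient of the partial sums
  constant as soon as more than \<open>k\<close> terms are included, which is convergence of formal power
  series.
\<close>

lemma fps_sums_X_powers:
  fixes f g :: "nat \<Rightarrow> nat"
  assumes f: "\<And>i. i \<le> f i" and g: "\<And>i. i \<le> g i"
  shows "(\<lambda>i. fps_X ^ f i + fps_X ^ g i) sums
    (Abs_fps (\<lambda>k. of_nat (card {i. f i = k} + card {i. g i = k})) :: 'a::comm_ring_1 fps)"
  unfolding sums_def
proof (rule tendsto_fpsI)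
  fix k :: nat
  have *: "fps_nth (\<Sum>i<n. fps_X ^ h i :: 'a fps) k = of_nat (card {i. h i = k})"
    if "\<And>i. i \<le> h i" "n > k" for h :: "nat \<Rightarrow> nat" and n
  proof -
    have "{i. i < n \<and> k = h i} = {i. h i = k}"
      using that by (auto intro: le_less_trans)
    then show ?thesis
      by (simp add: fps_sum_nth flip: sum.inter_filter)
  qed
  show "\<forall>\<^sub>F n in sequentially. fps_nth (\<Sum>i<n. fps_X ^ f i + fps_X ^ g i :: 'a fps) k =
      fps_nth (Abs_fps (\<lambda>k. of_nat (card {i. f i = k} + card {i. g i = k}))) k"
    using eventually_gt_at_top[of k] by eventually_elim (simp add: sum.distrib * f g)
qed

theorem theorem24:
  "(\<forall>k. card (indec_avoiders k {[1,2,3], [1,3,2], [2,1,3], [2,3,1]}) =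
        (if pascal_seq k > 1 then 0 else pascal_seq k)) \<and>
   (\<lambda>i::nat. fps_X ^ (i * (i + 1) div 2) + fps_X ^ ((i + 1) * (i + 4) div 2)) sums
     (Abs_fps (\<lambda>k. int (card (indec_avoiders k {[1,2,3], [1,3,2], [2,1,3], [2,3,1]}))) :: int fps)"
proof
  show "\<forall>k. card (indec_avoiders k {[1,2,3], [1,3,2], [2,1,3], [2,3,1]}) =
        (if pascal_seq k > 1 then 0 else pascal_seq k)"
    unfolding card_indec_avoiders using card_exponents_eq_pascal by blast
  have le: "i \<le> i * (i + 1) div 2" for i :: nat by (induction i) simp_all
  have "i \<le> (i + 1) * (i + 4) div 2" for i :: nat
    unfolding swap_exponent using le[of "Suc i"] by linarith
  from fps_sums_X_powers[OF le this]
  show "(\<lambda>i::nat. fps_X ^ (i * (i + 1) div 2) + fps_X ^ ((i + 1) * (i + 4) div 2)) sums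
     (Abs_fps (\<lambda>k. int (card (indec_avoiders k {[1,2,3], [1,3,2], [2,1,3], [2,3,1]}))) :: int fps)"
    unfolding card_indec_avoiders .
qed

end
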